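(* Let $f:\mathbb R^n\to\mathbb R$ be locally Lipschitz, let $C\subset\mathbb R^n$ be closed and convex, and suppose $f$ has a strict first-order model $\phi$. Let $x^1\in C$ be such that $\{x\in C: f(x)\le f(x^1)\}$ is bounded. Let $x^j\in C$ be the sequence of (serious) iterates generated by the bundle trust-region algorithm described in the context, started at $x^1$ and based on the model $\phi$. Then every accumulation point $x^*$ of the sequence $x^j$ is a critical point of the program $\min\{f(x): x\in C\}$.
   Context: **Notation.** $\partial f(x)$ is the Clarke subdifferential of $f$ at $x$; $\partial_1\phi$ is the Clarke (here: convex) subdifferential with respect to the first variable. $N_C(x)$ is the normal cone to the convex set $C$ at $x\in C$. A point $x\in C$ is a critical point of $\min\{f(x):x\in C\}$ if $0\in\partial f(x)+N_C(x)$. $\|\cdot\|$ is an arbitrary fixed norm on $\mathbb R^n$ and $B(x,R)$ the corresponding closed ball. **First-order model.** $\phi:\mathbb R^n\times\mathbb R^n\to\mathbb R$ is a first-order model of $f$ on a set $\Omega$ (here $\Omega\supset C$) if $\phi(\cdot,x)$ is convex for every $x\in\Omega$ and, for $x\in\Omega$: $(M_1)$ $\phi(x,x)=f(x)$ and $\partial_1\phi(x,x)\subset\partial f(x)$; $(M_2)$ if $y_k\to x$, there exist $\epsilon_k\to0^+$ with $f(y_k)\le\phi(y_k,x)+\epsilon_k\|y_k-x\|$; $(M_3)$ if $x_k\to x$ and $y_k\to y$, then $\limsup_{k\to\infty}\phi(y_k,x_k)\le\phi(y,x)$. The model is strict (at each $x\in\Omega$) if moreover $(\widetilde M_2)$: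 whenever $y_k\to x$, $x_k\to x$, there exist $\epsilon_k\to0^+$ with $f(y_k)\le\phi(y_k,x_k)+\epsilon_k\|y_k-x_k\|$. **Cutting planes and working models.** For a serious iterate $x$ and a point $z$ (trial step), a cutting plane of $f$ at serious iterate $x$ and trial step $z$ is an affine function $m(\cdot,x)=\phi(z,x)+g^\top(\cdot-z)$ with $g\in\partial_1\phi(z,x)$; it is written $m(\cdot,x)=a+g^\top(\cdot-x)$ with $a=\phi(z,x)+g^\top(x-z)$ and represented by the pair $(a,g)$. If $z=x$ it is called an exactness plane; it is represented by $(f(x),g_0)$ with $g_0\in\partial_1\phi(x,x)\subset\partial f(x)$. If $\mathcal G_k$ is a set of pairs representing cutting planes at serious iterate $x$, containing at least one exactness plane at $x$, then $\phi_k(y,x)=\max_{(a,g)\in\mathcal G_k}a+g^\top(y-x)$ is called a working model of $f$ at $x$. **Algorithm.** Parameters $0<\gamma<\widetilde\gamma<1$, $0<\gamma<\Gamma\le1$, $0<\theta<1$, $M\ge1$. 1. Choose the initial iterate $x^1\in C$ and the memory trust-region radius $R_1^\sharp>0$. Put $j=1$. 2. At outer counter $j$, stop if $x^j$ is a critical point. Otherwise go to the inner loop. 3. Put $k=1$, $R_1=R_j^\sharp$. Build an initial working model $\phi_1(\cdot,x^j)$ from a set $\mathcal G_1$ of cutting planes at serious iterate $x^j$ containing at least one exactness plane at $x^j$. 4. Find a solution $y^k$ of the tangent program: minimize $\phi_k(y,x^j)$ subject to $y\in C$, $\|y-x^j\|\le R_k$. Then choose any trial step $z^k\in C\cap B(x^j,M\|x^j-y^k\|)$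 satisfying $f(x^j)-\phi_k(z^k,x^j)\ge\theta\big(f(x^j)-\phi_k(y^k,x^j)\big)$. 5. If $\rho_k=\dfrac{f(x^j)-f(z^k)}{f(x^j)-\phi_k(z^k,x^j)}\ge\gamma$, put $x^{j+1}=z^k$ (serious step), quit the inner loop and go to 8. Otherwise (null step) continue with 6. 6. Generate a cutting plane at the null step $z^k$ and serious iterate $x^j$, i.e. $(a_k,g_k)$ with $g_k\in\partial_1\phi(z^k,x^j)$, $a_k=\phi(z^k,x^j)+g_k^\top(x^j-z^k)$. Form $\mathcal G_{k+1}$ from $\mathcal G_k$ by adding $(a_k,g_k)$, possibly adding further cutting planes, and possibly removing some older inactive planes of $\mathcal G_k$ (those not attaining the maximum in $\phi_k$ at the current trial step), always keeping an exactness plane. Build $\phi_{k+1}(\cdot,x^j)$ from $\mathcal G_{k+1}$. 7. Compute $\widetilde\rho_k=\dfrac{f(x^j)-\phi(z^k,x^j)}{f(x^j)-\phi_k(z^k,x^j)}$ and put $R_{k+1}=R_k$ if $\widetilde\rho_k<\widetilde\gamma$, $R_{k+1}=\frac12R_k$ if $\widetilde\rho_k\ge\widetilde\gamma$. Increase $k$ and go back to 4. 8. Put $R_{j+1}^\sharp=R_k$ if $\rho_k<\Gamma$ and $R_{j+1}^\sharp=2R_k$ if $\rho_k\ge\Gamma$ (with $k$ the counter at which the step was accepted). Increase $j$ and go back to 2. *)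

theory Defs
  imports "HOL-Analysis.Analysis"
begin

(* The underlying norm is arbitrary and in general differs from the Euclidean norm of the type.
   Nonnegativity follows from the three clauses. *)
definition is_norm :: "('a::real_vector \<Rightarrow> real) \<Rightarrow> bool" where
  "is_norm N \<longleftrightarrow>
     (\<forall>x. N x = 0 \<longleftrightarrow> x = 0) \<and>
     (\<forall>c x. N (c *\<^sub>R x) = \<bar>c\<bar> * N x) \<and>
     (\<forall>x y. N (x + y) \<le> N x + N y)"

definition locally_lipschitz :: "('a::metric_space \<Rightarrow> 'b::metric_space) \<Rightarrow> bool" where
  "locally_lipschitz f \<longleftrightarrow> (\<forall>x. \<exists>u>0. \<exists>L. L-lipschitz_on (cball x u) f)"

definition clarke_deriv :: "('a::real_inner \<Rightarrow> real) \<Rightarrow> 'a \<Rightarrow> 'a \<Rightarrow> ereal" where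
  "clarke_deriv f x d =
     Limsup (nhds x \<times>\<^sub>F at_right 0) (\<lambda>(y, t). ereal ((f (y + t *\<^sub>R d) - f y) / t))"

definition clarke_subdiff :: "('a::real_inner \<Rightarrow> real) \<Rightarrow> 'a \<Rightarrow> 'a set" where
  "clarke_subdiff f x = {g. \<forall>d. ereal (g \<bullet> d) \<le> clarke_deriv f x d}"

definition convex_subdiff :: "('a::real_inner \<Rightarrow> real) \<Rightarrow> 'a \<Rightarrow> 'a set" where
  "convex_subdiff h z = {g. \<forall>y. h z + g \<bullet> (y - z) \<le> h y}"

definition normal_cone :: "'a::real_inner set \<Rightarrow> 'a \<Rightarrow> 'a set" where
  "normal_cone C x = {v. \<forall>y\<in>C. v \<bullet> (y - x) \<le> 0}"

definition critical_point :: "('a::real_inner \<Rightarrow> real) \<Rightarrow> 'a set \<Rightarrow> 'a \<Rightarrow> bool" where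
  "critical_point f C x \<longleftrightarrow>
     x \<in> C \<and> 0 \<in> {g + v | g v. g \<in> clarke_subdiff f x \<and> v \<in> normal_cone C x}"

(* A model is written phi y x: the first argument is the free variable, the second one
   is the point at which f is modelled. *)
definition first_order_model ::
  "('a::euclidean_space \<Rightarrow> real) \<Rightarrow> ('a \<Rightarrow> real) \<Rightarrow> 'a set \<Rightarrow> ('a \<Rightarrow> 'a \<Rightarrow> real) \<Rightarrow> bool" where
  "first_order_model N f \<Omega> \<phi> \<longleftrightarrow> (\<forall>x\<in>\<Omega>.
     convex_on UNIV (\<lambda>y. \<phi> y x) \<and>
     \<phi> x x = f x \<and> convex_subdiff (\<lambda>y. \<phi> y x) x \<subseteq> clarke_subdiff f x \<and>
     (\<forall>ys. ys \<longlonglongrightarrow> x \<longrightarrow>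
        (\<exists>\<epsilon>::nat \<Rightarrow> real. (\<forall>k. \<epsilon> k > 0) \<and> \<epsilon> \<longlonglongrightarrow> 0 \<and>
           (\<forall>k. f (ys k) \<le> \<phi> (ys k) x + \<epsilon> k * N (ys k - x)))) \<and>
     (\<forall>xs ys y. xs \<longlonglongrightarrow> x \<and> ys \<longlonglongrightarrow> y \<longrightarrow>
        limsup (\<lambda>k. ereal (\<phi> (ys k) (xs k))) \<le> ereal (\<phi> y x)))"

definition strict_first_order_model ::
  "('a::euclidean_space \<Rightarrow> real) \<Rightarrow> ('a \<Rightarrow> real) \<Rightarrow> 'a set \<Rightarrow> ('a \<Rightarrow> 'a \<Rightarrow> real) \<Rightarrow> bool" where
  "strict_first_order_model N f \<Omega> \<phi> \<longleftrightarrow>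
     first_order_model N f \<Omega> \<phi> \<and>
     (\<forall>x\<in>\<Omega>. \<forall>xs ys. xs \<longlonglongrightarrow> x \<and> ys \<longlonglongrightarrow> x \<longrightarrow>
        (\<exists>\<epsilon>::nat \<Rightarrow> real. (\<forall>k. \<epsilon> k > 0) \<and> \<epsilon> \<longlonglongrightarrow> 0 \<and>
           (\<forall>k. f (ys k) \<le> \<phi> (ys k) (xs k) + \<epsilon> k * N (ys k - xs k))))"

text \<open>A pair \<open>(a, g)\<close> represents the affine function \<open>y \<mapsto> a + g \<bullet> (y - x)\<close>, where \<open>x\<close> is
  the current serious iterate.\<close>

definition plane_val :: "real \<times> 'a::real_inner \<Rightarrow> 'a \<Rightarrow> 'a \<Rightarrow> real" where
  "plane_val p y x = fst p + snd p \<bullet> (y - x)"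

definition cutting_planes_at ::
  "('a::real_inner \<Rightarrow> 'a \<Rightarrow> real) \<Rightarrow> 'a \<Rightarrow> 'a \<Rightarrow> (real \<times> 'a) set" where
  "cutting_planes_at \<phi> z x = {(\<phi> z x + g \<bullet> (x - z), g) | g. g \<in> convex_subdiff (\<lambda>y. \<phi> y x) z}"

definition exactness_planes ::
  "('a::real_inner \<Rightarrow> real) \<Rightarrow> ('a \<Rightarrow> 'a \<Rightarrow> real) \<Rightarrow> 'a \<Rightarrow> (real \<times> 'a) set" where
  "exactness_planes f \<phi> x = {(f x, g) | g. g \<in> convex_subdiff (\<lambda>y. \<phi> y x) x}"

(* The set need not be finite; the last clause says that the maximum defining the
   working model exists at every y, which is automatic for finite sets. *)
definition admissible_planes ::
  "('a::real_inner \<Rightarrow> real) \<Rightarrow> ('a \<Rightarrow> 'a \<Rightarrow> real) \<Rightarrow> 'a \<Rightarrow> (real \<times> 'a) set \<Rightarrow> bool" where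
  "admissible_planes f \<phi> x G \<longleftrightarrow>
     G \<subseteq> (\<Union>z. cutting_planes_at \<phi> z x) \<and>
     G \<inter> exactness_planes f \<phi> x \<noteq> {} \<and>
     (\<forall>y. \<exists>p\<in>G. \<forall>q\<in>G. plane_val q y x \<le> plane_val p y x)"

(* For admissible G the supremum is attained, i.e. it is the maximum. *)
definition working_model :: "(real \<times> 'a::real_inner) set \<Rightarrow> 'a \<Rightarrow> 'a \<Rightarrow> real" where
  "working_model G y x = (SUP p\<in>G. plane_val p y x)"

definition tangent_solution ::
  "'a::real_inner set \<Rightarrow> ('a \<Rightarrow> real) \<Rightarrow> (real \<times> 'a) set \<Rightarrow> 'a \<Rightarrow> real \<Rightarrow> 'a \<Rightarrow> bool" where
  "tangent_solution C N G x R y \<longleftrightarrow>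
     y \<in> C \<and> N (y - x) \<le> R \<and>
     (\<forall>w\<in>C. N (w - x) \<le> R \<longrightarrow> working_model G y x \<le> working_model G w x)"

definition trial_step ::
  "('a::real_inner \<Rightarrow> real) \<Rightarrow> 'a set \<Rightarrow> ('a \<Rightarrow> real) \<Rightarrow> real \<Rightarrow> real \<Rightarrow> (real \<times> 'a) set
     \<Rightarrow> 'a \<Rightarrow> 'a \<Rightarrow> 'a \<Rightarrow> bool" where
  "trial_step f C N \<theta> M G x y z \<longleftrightarrow>
     z \<in> C \<and> N (z - x) \<le> M * N (x - y) \<and>
     f x - working_model G z x \<ge> \<theta> * (f x - working_model G y x)"

definition rho :: "('a::real_inner \<Rightarrow> real) \<Rightarrow> (real \<times> 'a) set \<Rightarrow> 'a \<Rightarrow> 'a \<Rightarrow> real" where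
  "rho f G x z = (f x - f z) / (f x - working_model G z x)"

definition rho_tilde ::
  "('a::real_inner \<Rightarrow> real) \<Rightarrow> ('a \<Rightarrow> 'a \<Rightarrow> real) \<Rightarrow> (real \<times> 'a) set \<Rightarrow> 'a \<Rightarrow> 'a \<Rightarrow> real" where
  "rho_tilde f \<phi> G x z = (f x - \<phi> z x) / (f x - working_model G z x)"

(* Transition from G to G' after a null step z: every plane that is active at z is kept, a
   cutting plane at z is added, and everything else about G' is free. *)
definition update_planes ::
  "('a::real_inner \<Rightarrow> real) \<Rightarrow> ('a \<Rightarrow> 'a \<Rightarrow> real) \<Rightarrow> 'a \<Rightarrow> 'a \<Rightarrow> (real \<times> 'a) set
     \<Rightarrow> (real \<times> 'a) set \<Rightarrow> bool" where
  "update_planes f \<phi> x z G G' \<longleftrightarrow>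
     admissible_planes f \<phi> x G' \<and>
     G' \<inter> cutting_planes_at \<phi> z x \<noteq> {} \<and>
     {p \<in> G. plane_val p z x = working_model G z x} \<subseteq> G'"

text \<open>One pass through the inner loop. The inner counter runs over \<open>1 \<le> k\<close>, \<open>enat k \<le> in_last\<close>;
  \<open>in_last = \<infinity>\<close> describes an inner loop that never accepts a trial step.\<close>

record 'a inner_run =
  in_planes :: "nat \<Rightarrow> (real \<times> 'a) set"
  in_tangent :: "nat \<Rightarrow> 'a"
  in_trial :: "nat \<Rightarrow> 'a"
  in_radius :: "nat \<Rightarrow> real"
  in_last :: enat

definition inner_loop ::
  "('a::real_inner \<Rightarrow> real) \<Rightarrow> ('a \<Rightarrow> 'a \<Rightarrow> real) \<Rightarrow> 'a set \<Rightarrow> ('a \<Rightarrow> real)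
     \<Rightarrow> real \<Rightarrow> real \<Rightarrow> real \<Rightarrow> real \<Rightarrow> 'a \<Rightarrow> real \<Rightarrow> 'a inner_run \<Rightarrow> bool" where
  "inner_loop f \<phi> C N \<gamma> \<gamma>' \<theta> M x R\<^sub>0 I \<longleftrightarrow>
     1 \<le> in_last I \<and>
     in_radius I 1 = R\<^sub>0 \<and>
     admissible_planes f \<phi> x (in_planes I 1) \<and>
     (\<forall>k\<ge>1. enat k \<le> in_last I \<longrightarrow>
        tangent_solution C N (in_planes I k) x (in_radius I k) (in_tangent I k) \<and>
        trial_step f C N \<theta> M (in_planes I k) x (in_tangent I k) (in_trial I k) \<and>
        (enat k = in_last I \<longleftrightarrow> rho f (in_planes I k) x (in_trial I k) \<ge> \<gamma>)) \<and>
     (\<forall>k\<ge>1. enat k < in_last I \<longrightarrow>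
        update_planes f \<phi> x (in_trial I k) (in_planes I k) (in_planes I (Suc k)) \<and>
        in_radius I (Suc k) =
          (if rho_tilde f \<phi> (in_planes I k) x (in_trial I k) < \<gamma>'
           then in_radius I k else in_radius I k / 2))"

text \<open>A complete run of the algorithm. The serious iterates are \<open>serious j\<close> for \<open>1 \<le> j\<close>,
  \<open>enat j \<le> last_serious\<close>. There is a last one iff the algorithm stops there at a critical point
  or the inner loop entered there never accepts a trial step.\<close>

record 'a tr_run =
  serious :: "nat \<Rightarrow> 'a"
  memory_radius :: "nat \<Rightarrow> real"
  inner_at :: "nat \<Rightarrow> 'a inner_run"
  last_serious :: enat

definition bundle_trust_region_run ::
  "('a::real_inner \<Rightarrow> real) \<Rightarrow> ('a \<Rightarrow> 'a \<Rightarrow> real) \<Rightarrow> 'a set \<Rightarrow> ('a \<Rightarrow> real)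
     \<Rightarrow> real \<Rightarrow> real \<Rightarrow> real \<Rightarrow> real \<Rightarrow> real \<Rightarrow> 'a \<Rightarrow> 'a tr_run \<Rightarrow> bool" where
  "bundle_trust_region_run f \<phi> C N \<gamma> \<gamma>' \<Gamma> \<theta> M x\<^sub>1 T \<longleftrightarrow>
     1 \<le> last_serious T \<and>
     serious T 1 = x\<^sub>1 \<and> memory_radius T 1 > 0 \<and>
     (\<forall>j\<ge>1. enat j \<le> last_serious T \<longrightarrow>
        (\<not> critical_point f C (serious T j) \<longrightarrow>
           inner_loop f \<phi> C N \<gamma> \<gamma>' \<theta> M (serious T j) (memory_radius T j) (inner_at T j)) \<and>
        (enat j = last_serious T \<longleftrightarrow>
           critical_point f C (serious T j) \<or> in_last (inner_at T j) = \<infinity>)) \<and>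
     (\<forall>j\<ge>1. enat j < last_serious T \<longrightarrow>
        (\<exists>k. in_last (inner_at T j) = enat k \<and>
           serious T (Suc j) = in_trial (inner_at T j) k \<and>
           memory_radius T (Suc j) =
             (if rho f (in_planes (inner_at T j) k) (serious T j) (in_trial (inner_at T j) k) < \<Gamma>
              then in_radius (inner_at T j) k else 2 * in_radius (inner_at T j) k)))"

(* A finite sequence of serious iterates has no accumulation point. *)
definition accumulation_point_of_run :: "'a::topological_space tr_run \<Rightarrow> 'a \<Rightarrow> bool" where
  "accumulation_point_of_run T l \<longleftrightarrow>
     (\<forall>U. open U \<and> l \<in> U \<longrightarrow> infinite {j. 1 \<le> j \<and> enat j \<le> last_serious T \<and> serious T j \<in> U})"

end

theory Submission
  imports Defs
begin

text \<open>
  Suppose the accumulation point \<open>x\<^sup>*\<close> is not critical. Three facts then collide.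

  First, \<open>x\<^sup>*\<close> does not minimize the convex function \<open>\<phi>(\<cdot>, x\<^sup>*)\<close> over \<open>C\<close>, since a minimizer would be
  critical by the convex optimality condition (\<open>model_minimizer_critical\<close>). A point of \<open>C\<close> at which
  the model is smaller serves, by the semicontinuity \<open>(M\<^sub>3)\<close>, for all \<open>x\<close> near \<open>x\<^sup>*\<close> at once. Moving
  from \<open>x\<close> towards that point shows that the decrease available within radius \<open>R\<close> is at least
  \<open>c min(R, r)\<close> with constants that do not depend on \<open>x\<close> (\<open>uniform_model_decrease\<close>). Working models
  lie below \<open>\<phi>\<close>, so every trial step inherits this decrease up to the factor \<open>\<theta>\<close>.

  Second, halving the radius takes a trial step \<open>z\<close> with ratio below \<open>\<gamma>\<close> for \<open>f\<close> but at least \<open>\<gamma>'\<close> for \<open>\<phi>\<close>,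
  so that \<open>f z - \<phi>(z, x)\<close> is at least a fixed fraction of the predicted decrease, hence of \<open>R\<close>.
  For \<open>x\<close> near \<open>x\<^sup>*\<close> and \<open>R\<close> small, strictness makes the same difference \<open>o(R)\<close>. Therefore no
  inner loop entered near \<open>x\<^sup>*\<close> with a small radius ever halves it (\<open>no_halving_near_noncritical\<close>).

  Third, the values \<open>f(x\<^sup>j)\<close> decrease and converge to \<open>f(x\<^sup>*)\<close>, while a serious step near \<open>x\<^sup>*\<close> makes
  \<open>f\<close> decrease by at least a multiple of its radius, hence of its length. Once close to \<open>x\<^sup>*\<close> with little
  decrease left, the iterates can therefore not move away, and the accepted radii tend to zero
  (\<open>descent_traps_iterates\<close>).

  But the radius can shrink only by halving, which by the second fact eventually never happens: the
  accepted radii are positive and eventually nondecreasing, so they do not tend to zero.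
\<close>


section \<open>Norms on Euclidean spaces\<close>

lemma is_norm_zero: "is_norm N \<Longrightarrow> N 0 = 0"
  and is_norm_scale: "is_norm N \<Longrightarrow> N (c *\<^sub>R x) = \<bar>c\<bar> * N x"
  and is_norm_triangle: "is_norm N \<Longrightarrow> N (x + y) \<le> N x + N y"
  and is_norm_eq_zero: "is_norm N \<Longrightarrow> N x = 0 \<longleftrightarrow> x = 0"
  by (auto simp: is_norm_def)

lemma is_norm_minus:
  assumes "is_norm N" shows "N (- x) = N x"
  using is_norm_scale[OF assms, of "-1" x] by simp

lemma is_norm_minus_commute:
  assumes "is_norm N" shows "N (x - y) = N (y - x)"
  using is_norm_minus[OF assms, of "x - y"] by simp

lemma is_norm_nonneg:
  assumes "is_norm N" shows "0 \<le> N x"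
  using is_norm_triangle[OF assms, of x "- x"] is_norm_minus[OF assms, of x] is_norm_zero[OF assms]
  by simp

lemma is_norm_continuous:
  fixes N :: "'a::euclidean_space \<Rightarrow> real"
  assumes "is_norm N" shows "continuous_on UNIV N"
proof (rule convex_on_continuous[OF open_UNIV])
  show "convex_on UNIV N"
  proof (rule convex_onI)
    fix t x y assume t: "0 < (t::real)" "t < 1"
    have "N ((1 - t) *\<^sub>R x + t *\<^sub>R y) \<le> N ((1 - t) *\<^sub>R x) + N (t *\<^sub>R y)"
      by (rule is_norm_triangle[OF assms])
    also have "\<dots> = (1 - t) * N x + t * N y"
      using t by (simp add: is_norm_scale[OF assms])
    finally show "N ((1 - t) *\<^sub>R x + t *\<^sub>R y) \<le> (1 - t) * N x + t * N y" .
  qed simp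
qed

lemma is_norm_dominates:
  fixes N :: "'a::euclidean_space \<Rightarrow> real"
  assumes "is_norm N"
  obtains K where "0 < K" "\<And>v. norm v \<le> K * N v"
proof -
  have "sphere (0::'a) 1 \<noteq> {}" by simp
  then obtain u where u: "u \<in> sphere 0 1" "\<And>v. v \<in> sphere 0 1 \<Longrightarrow> N u \<le> N v"
    using continuous_attains_inf[of "sphere (0::'a) 1" N]
      continuous_on_subset[OF is_norm_continuous[OF assms]] by auto
  have "u \<noteq> 0" using u(1) by auto
  then have pos: "0 < N u"
    using is_norm_nonneg[OF assms, of u] is_norm_eq_zero[OF assms, of u] by linarith
  have "norm v \<le> (1 / N u) * N v" for v
  proof (cases "v = 0")
    case True
    then show ?thesis by (simp add: is_norm_zero[OF assms])
  next
    case False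
    then have "N u \<le> N ((1 / norm v) *\<^sub>R v)" by (intro u(2)) simp
    also have "\<dots> = N v / norm v" by (simp add: is_norm_scale[OF assms])
    finally show ?thesis using pos False by (simp add: field_simps)
  qed
  with pos show thesis by (intro that[of "1 / N u"]) auto
qed


section \<open>Optimality for convex functions and first-order models\<close>

text \<open>The strict epigraph of \<open>h\<close> and the set of points below the level \<open>h x\<close> over \<open>C\<close> are
  disjoint and convex. A hyperplane separating them is not vertical because \<open>h\<close> is finite
  everywhere, so its slope is both a subgradient and, up to sign, a normal vector.\<close>
lemma convex_constrained_min_subgradient:
  fixes h :: "'a::euclidean_space \<Rightarrow> real"
  assumes h: "convex_on UNIV h" and C: "convex C" and x: "x \<in> C"
    and min: "\<And>y. y \<in> C \<Longrightarrow> h x \<le> h y"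
  obtains g where "g \<in> convex_subdiff h x" "- g \<in> normal_cone C x"
proof -
  define A where "A = C \<times> {..h x}"
  define B where "B = {p. h (fst p) < snd p}"
  have "convex A" unfolding A_def by (intro convex_Times C) simp
  moreover have "convex B"
  proof (rule convexI)
    fix p q and u v :: real
    assume pq: "p \<in> B" "q \<in> B" and uv: "0 \<le> u" "0 \<le> v" "u + v = 1"
    have "h (u *\<^sub>R fst p + v *\<^sub>R fst q) \<le> u * h (fst p) + v * h (fst q)"
      using h uv unfolding convex_on_def by auto
    also have "\<dots> < u * snd p + v * snd q"
    proof (cases "u = 0")
      case True
      then show ?thesis using uv pq by (simp add: B_def)
    next
      case False
      then have "u * h (fst p) < u * snd p" using uv pq by (simp add: B_def)
      moreover have "v * h (fst q) \<le> v * snd q"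
        using uv pq by (intro mult_left_mono) (auto simp: B_def)
      ultimately show ?thesis by linarith
    qed
    finally show "u *\<^sub>R p + v *\<^sub>R q \<in> B" by (simp add: B_def)
  qed
  moreover have "A \<noteq> {}" using x by (auto simp: A_def)
  moreover have "(x, h x + 1) \<in> B" by (simp add: B_def)
  moreover have "A \<inter> B = {}" using min by (fastforce simp: A_def B_def)
  ultimately obtain a b where a: "a \<noteq> 0" "\<forall>p\<in>A. a \<bullet> p \<le> b" "\<forall>p\<in>B. b \<le> a \<bullet> p"
    using separating_hyperplane_sets[of A B] by blast
  obtain u s where us: "a = (u, s)" by (cases a)
  have below: "u \<bullet> y + s * h x \<le> b" if "y \<in> C" for y
    using a(2) that by (auto simp: us A_def)
  have above: "b \<le> u \<bullet> y + s * (h y + e)" if "0 < e" for y e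
    using a(3) that by (auto simp: us B_def dest: bspec[of _ _ "(y, h y + e)"])
  have "0 \<le> s" using below[OF x] above[of 1 x] by (simp add: algebra_simps)
  moreover have "s \<noteq> 0"
  proof
    assume "s = 0"
    then have "u \<bullet> x \<le> b" "b \<le> u \<bullet> (x - u)" using below[OF x] above[of 1 "x - u"] by auto
    then have "u \<bullet> u \<le> 0" by (simp add: inner_diff_right)
    then have "u = 0" by (metis inner_eq_zero_iff inner_ge_zero order_antisym)
    with a(1) us \<open>s = 0\<close> show False by (simp add: zero_prod_def)
  qed
  ultimately have s: "0 < s" by simp
  have above': "b \<le> u \<bullet> y + s * h y" for y
  proof (rule field_le_epsilon)
    fix e :: real assume "0 < e"
    then show "b \<le> u \<bullet> y + s * h y + e" using above[of "e / s" y] s by (simp add: algebra_simps)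
  qed
  define g where "g = - (1 / s) *\<^sub>R u"
  have gu: "s * (g \<bullet> v) = - (u \<bullet> v)" for v using s by (simp add: g_def)
  have "h x + g \<bullet> (y - x) \<le> h y" for y
  proof -
    have "s * (h x + g \<bullet> (y - x)) \<le> s * h y"
      using below[OF x] above'[of y] gu[of "y - x"] by (simp add: distrib_left inner_diff_right)
    then show ?thesis using s by simp
  qed
  moreover have "- g \<bullet> (y - x) \<le> 0" if "y \<in> C" for y
  proof -
    have "0 \<le> s * (g \<bullet> (y - x))"
      using below[OF that] above'[of x] gu[of "y - x"] by (simp add: inner_diff_right)
    then show ?thesis using s by (simp add: zero_le_mult_iff)
  qed
  ultimately show thesis by (intro that[of g]) (auto simp: convex_subdiff_def normal_cone_def)
qed

lemma first_order_modelD: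
  assumes "first_order_model N f \<Omega> \<phi>" "x \<in> \<Omega>"
  shows "convex_on UNIV (\<lambda>y. \<phi> y x)" "\<phi> x x = f x"
    and "convex_subdiff (\<lambda>y. \<phi> y x) x \<subseteq> clarke_subdiff f x"
    and "\<And>xs ys y. xs \<longlonglongrightarrow> x \<Longrightarrow> ys \<longlonglongrightarrow> y
           \<Longrightarrow> limsup (\<lambda>k. ereal (\<phi> (ys k) (xs k))) \<le> ereal (\<phi> y x)"
  using assms unfolding first_order_model_def by blast+

lemma model_minimizer_critical:
  assumes model: "first_order_model N f \<Omega> \<phi>" and "x \<in> \<Omega>" "convex C" "x \<in> C"
    and min: "\<And>y. y \<in> C \<Longrightarrow> f x \<le> \<phi> y x"
  shows "critical_point f C x"
proof -
  note D = first_order_modelD[OF model \<open>x \<in> \<Omega>\<close>]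
  obtain g where g: "g \<in> convex_subdiff (\<lambda>y. \<phi> y x) x" "- g \<in> normal_cone C x"
    using convex_constrained_min_subgradient[OF D(1) \<open>convex C\<close> \<open>x \<in> C\<close>] min D(2) by auto
  then have "g \<in> clarke_subdiff f x" using D(3) by auto
  with g(2) have "\<exists>g v. 0 = g + v \<and> g \<in> clarke_subdiff f x \<and> v \<in> normal_cone C x"
    by (metis add.right_inverse)
  then show ?thesis using \<open>x \<in> C\<close> by (simp add: critical_point_def)
qed

lemma model_upper_semicontinuous:
  assumes model: "first_order_model N f \<Omega> \<phi>" and "x \<in> \<Omega>" and "\<phi> w x < b"
  shows "\<forall>\<^sub>F x' in nhds x. \<phi> w x' < b"
proof (rule iffD2[OF eventually_nhds_iff_sequentially], intro allI impI)
  fix xs assume "xs \<longlonglongrightarrow> x"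
  then have "limsup (\<lambda>k. ereal (\<phi> w (xs k))) \<le> ereal (\<phi> w x)"
    by (intro first_order_modelD(4)[OF model \<open>x \<in> \<Omega>\<close>, where ys = "\<lambda>_. w"]) auto
  also have "\<dots> < ereal b" using \<open>\<phi> w x < b\<close> by simp
  finally show "\<forall>\<^sub>F k in sequentially. \<phi> w (xs k) < b" by (auto dest: Limsup_lessD)
qed

text \<open>The sequences in the strictness condition are arbitrary, so one \<open>\<epsilon>\<close> serves for a whole
  neighbourhood of the diagonal point.\<close>
lemma strict_model_locally_uniform:
  assumes N: "is_norm N" and model: "strict_first_order_model N f \<Omega> \<phi>" and "x \<in> \<Omega>" and "0 < e"
  obtains \<delta> where "0 < \<delta>"
    and "\<And>x' z. dist x' x < \<delta> \<Longrightarrow> dist z x < \<delta> \<Longrightarrow> f z \<le> \<phi> z x' + e * N (z - x')"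
proof -
  have "\<forall>\<^sub>F p in nhds (x, x). f (snd p) \<le> \<phi> (snd p) (fst p) + e * N (snd p - fst p)"
  proof (rule iffD2[OF eventually_nhds_iff_sequentially], intro allI impI)
    fix ps assume ps: "ps \<longlonglongrightarrow> (x, x)"
    have "(\<lambda>k. fst (ps k)) \<longlonglongrightarrow> x" "(\<lambda>k. snd (ps k)) \<longlonglongrightarrow> x"
      using tendsto_fst[OF ps] tendsto_snd[OF ps] by auto
    then obtain \<epsilon> :: "nat \<Rightarrow> real" where \<epsilon>: "\<epsilon> \<longlonglongrightarrow> 0"
      "\<And>k. f (snd (ps k)) \<le> \<phi> (snd (ps k)) (fst (ps k)) + \<epsilon> k * N (snd (ps k) - fst (ps k))"
      using model \<open>x \<in> \<Omega>\<close> unfolding strict_first_order_model_def by meson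
    have "\<forall>\<^sub>F k in sequentially. \<epsilon> k < e" using order_tendstoD(2)[OF \<epsilon>(1) \<open>0 < e\<close>] .
    then show "\<forall>\<^sub>F k in sequentially.
        f (snd (ps k)) \<le> \<phi> (snd (ps k)) (fst (ps k)) + e * N (snd (ps k) - fst (ps k))"
    proof eventually_elim
      case (elim k)
      have "\<epsilon> k * N (snd (ps k) - fst (ps k)) \<le> e * N (snd (ps k) - fst (ps k))"
        using elim is_norm_nonneg[OF N] by (intro mult_right_mono) auto
      with \<epsilon>(2)[of k] show ?case by linarith
    qed
  qed
  then obtain P Q where P: "eventually P (nhds x)" and Q: "eventually Q (nhds x)"
    and PQ: "\<And>x' z. P x' \<Longrightarrow> Q z \<Longrightarrow> f z \<le> \<phi> z x' + e * N (z - x')"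
    unfolding nhds_prod eventually_prod_filter by auto
  from eventually_conj[OF P Q] obtain \<delta> where "0 < \<delta>" "\<And>v. dist v x < \<delta> \<Longrightarrow> P v \<and> Q v"
    unfolding eventually_nhds_metric by auto
  with PQ show thesis by (intro that[of \<delta>]) auto
qed

text \<open>Noncriticality gives one point \<open>w\<close> of \<open>C\<close> with \<open>\<phi>(w, x\<^sup>*) < f(x\<^sup>*)\<close>. Semicontinuity keeps a gap
  \<open>\<eta>\<close> for nearby \<open>x\<close>, and by convexity the point at the fraction \<open>t\<close> of the way from \<open>x\<close> to \<open>w\<close>
  realizes a decrease of at least \<open>t \<eta>\<close>.\<close>
lemma uniform_model_decrease:
  fixes N f :: "'a::euclidean_space \<Rightarrow> real"
  assumes N: "is_norm N" and model: "first_order_model N f \<Omega> \<phi>" and f: "isCont f x\<^sub>0"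
    and C: "convex C" "C \<subseteq> \<Omega>" "x\<^sub>0 \<in> C" and noncrit: "\<not> critical_point f C x\<^sub>0"
  obtains c r \<delta> where "0 < c" "0 < r" "0 < \<delta>"
    and "\<And>x R. x \<in> C \<Longrightarrow> dist x x\<^sub>0 < \<delta> \<Longrightarrow> 0 < R
           \<Longrightarrow> \<exists>w\<in>C. N (w - x) \<le> R \<and> c * min R r \<le> f x - \<phi> w x"
proof -
  have "x\<^sub>0 \<in> \<Omega>" using C by auto
  obtain w where w: "w \<in> C" "\<phi> w x\<^sub>0 < f x\<^sub>0"
    using model_minimizer_critical[OF model \<open>x\<^sub>0 \<in> \<Omega>\<close> C(1,3)] noncrit by force
  define \<eta> where "\<eta> = (f x\<^sub>0 - \<phi> w x\<^sub>0) / 3"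
  have \<eta>: "0 < \<eta>" "f x\<^sub>0 = \<phi> w x\<^sub>0 + 3 * \<eta>" using w by (simp_all add: \<eta>_def field_simps)
  define r where "r = N (w - x\<^sub>0) / 2"
  have "w \<noteq> x\<^sub>0" using w first_order_modelD(2)[OF model \<open>x\<^sub>0 \<in> \<Omega>\<close>] by auto
  then have r: "0 < r"
    using is_norm_nonneg[OF N, of "w - x\<^sub>0"] is_norm_eq_zero[OF N, of "w - x\<^sub>0"] by (simp add: r_def)
  \<comment> \<open>Near \<open>x\<^sub>0\<close> the distance to \<open>w\<close> stays between \<open>r\<close> and \<open>3 r\<close>, so that fractions of the segment
    and radii are comparable.\<close>
  have "((\<lambda>x. N (w - x)) \<longlongrightarrow> N (w - x\<^sub>0)) (nhds x\<^sub>0)"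
    using is_norm_continuous[OF N]
    by (intro continuous_on_tendsto_compose[of UNIV N] tendsto_intros filterlim_ident) auto
  from order_tendstoD(1)[OF this, of r] order_tendstoD(2)[OF this, of "3 * r"]
  have "\<forall>\<^sub>F x in nhds x\<^sub>0. r < N (w - x)" "\<forall>\<^sub>F x in nhds x\<^sub>0. N (w - x) < 3 * r"
    using r by (simp_all add: r_def)
  moreover have "\<forall>\<^sub>F x in nhds x\<^sub>0. \<phi> w x < \<phi> w x\<^sub>0 + \<eta>"
    using \<eta>(1) by (intro model_upper_semicontinuous[OF model \<open>x\<^sub>0 \<in> \<Omega>\<close>]) simp
  moreover have "\<forall>\<^sub>F x in nhds x\<^sub>0. f x\<^sub>0 - \<eta> < f x"
    using f \<eta>(1) by (intro order_tendstoD(1)[of f "f x\<^sub>0"])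
      (simp_all add: continuous_at tendsto_at_iff_tendsto_nhds)
  ultimately have "\<forall>\<^sub>F x in nhds x\<^sub>0. r < N (w - x) \<and> N (w - x) < 3 * r \<and> \<eta> \<le> f x - \<phi> w x"
    by eventually_elim (use \<eta>(2) in auto)
  then obtain \<delta> where \<delta>: "0 < \<delta>"
    "\<And>x. dist x x\<^sub>0 < \<delta> \<Longrightarrow> r < N (w - x) \<and> N (w - x) < 3 * r \<and> \<eta> \<le> f x - \<phi> w x"
    unfolding eventually_nhds_metric by auto
  show thesis
  proof (rule that[of "\<eta> / (3 * r)" r \<delta>])
    fix x and R :: real assume x: "x \<in> C" "dist x x\<^sub>0 < \<delta>" and "0 < R"
    note near = \<delta>(2)[OF x(2)]
    define t where "t = min R r / N (w - x)"
    have t: "0 < t" "t \<le> 1" using near r \<open>0 < R\<close> by (auto simp: t_def)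
    define v where "v = (1 - t) *\<^sub>R x + t *\<^sub>R w"
    have "v \<in> C" unfolding v_def using C(1) x w t by (intro convexD) auto
    moreover have "N (v - x) \<le> R"
    proof -
      have "v - x = t *\<^sub>R (w - x)" by (simp add: v_def algebra_simps)
      then have "N (v - x) = t * N (w - x)" using t by (simp add: is_norm_scale[OF N])
      also have "\<dots> = min R r" using near r by (simp add: t_def)
      finally show ?thesis by simp
    qed
    moreover have "\<eta> / (3 * r) * min R r \<le> f x - \<phi> v x"
    proof -
      have "x \<in> \<Omega>" using x C by auto
      note D = first_order_modelD[OF model this]
      have "\<phi> v x \<le> (1 - t) * f x + t * \<phi> w x"
        using convex_onD[OF D(1), of t x w] t by (simp add: v_def D(2))
      then have "t * (f x - \<phi> w x) \<le> f x - \<phi> v x" by (simp add: algebra_simps)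
      moreover have "t * \<eta> \<le> t * (f x - \<phi> w x)" using near t by (intro mult_left_mono) auto
      moreover have "\<eta> / (3 * r) * min R r \<le> t * \<eta>"
      proof -
        have "min R r / (3 * r) \<le> t"
          unfolding t_def using near r \<open>0 < R\<close> by (intro divide_left_mono) auto
        from mult_right_mono[OF this, of \<eta>] \<eta> show ?thesis by (simp add: mult.commute)
      qed
      ultimately show ?thesis by linarith
    qed
    ultimately show "\<exists>w\<in>C. N (w - x) \<le> R \<and> \<eta> / (3 * r) * min R r \<le> f x - \<phi> w x" by blast
  qed (use \<eta> r \<delta> in auto)
qed


section \<open>Working models and trial steps\<close>

lemma working_model_attained:
  assumes "admissible_planes f \<phi> x G"
  obtains p where "p \<in> G" "working_model G y x = plane_val p y x"
    and "\<And>q. q \<in> G \<Longrightarrow> plane_val q y x \<le> plane_val p y x"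
proof -
  obtain p where p: "p \<in> G" "\<And>q. q \<in> G \<Longrightarrow> plane_val q y x \<le> plane_val p y x"
    using assms unfolding admissible_planes_def by blast
  then have "working_model G y x = plane_val p y x"
    unfolding working_model_def by (intro cSup_eq_maximum) auto
  with p that show thesis by blast
qed

lemma working_model_le:
  assumes G: "admissible_planes f \<phi> x G"
  shows "working_model G y x \<le> \<phi> y x"
proof -
  obtain p where p: "p \<in> G" "working_model G y x = plane_val p y x"
    using working_model_attained[OF G] by blast
  then obtain z g where "p = (\<phi> z x + g \<bullet> (x - z), g)" "g \<in> convex_subdiff (\<lambda>y. \<phi> y x) z"
    using G unfolding admissible_planes_def cutting_planes_at_def by blast
  then show ?thesis using p(2)
    by (auto simp: plane_val_def convex_subdiff_def inner_diff_right dest: spec[of _ y])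
qed

text \<open>The solution of the tangent program does at least as well as any admissible competitor \<open>w\<close>,
  and the working model lies below the model at \<open>w\<close>. When \<open>\<phi>(x, x) = f x\<close>, the competitor
  \<open>w = x\<close> shows that the predicted decrease is not negative.\<close>
lemma trial_step_decrease:
  assumes G: "admissible_planes f \<phi> x G" and "tangent_solution C N G x R y"
    and "trial_step f C N \<theta> M G x y z" and "0 < \<theta>" and w: "w \<in> C" "N (w - x) \<le> R"
  shows "\<theta> * (f x - \<phi> w x) \<le> f x - working_model G z x"
proof -
  have "working_model G y x \<le> working_model G w x"
    using assms(2) w by (simp add: tangent_solution_def)
  also have "\<dots> \<le> \<phi> w x" by (rule working_model_le[OF G])
  finally have "\<theta> * (f x - \<phi> w x) \<le> \<theta> * (f x - working_model G y x)" using \<open>0 < \<theta>\<close> by simp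
  also have "\<dots> \<le> f x - working_model G z x" using assms(3) by (simp add: trial_step_def)
  finally show ?thesis .
qed

lemma trial_step_length:
  assumes N: "is_norm N" and "tangent_solution C N G x R y" "trial_step f C N \<theta> M G x y z" "1 \<le> M"
  shows "N (z - x) \<le> M * R"
proof -
  have "M * N (x - y) \<le> M * R"
    using assms by (intro mult_left_mono)
      (auto simp: tangent_solution_def is_norm_minus_commute[OF N, of x])
  then show ?thesis using assms(3) by (simp add: trial_step_def)
qed


section \<open>The inner loop\<close>

lemma inner_loop_step:
  assumes "inner_loop f \<phi> C N \<gamma> \<gamma>' \<theta> M x R\<^sub>0 I" "1 \<le> k" "enat k \<le> in_last I"
  shows "tangent_solution C N (in_planes I k) x (in_radius I k) (in_tangent I k)"
    and "trial_step f C N \<theta> M (in_planes I k) x (in_tangent I k) (in_trial I k)"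
    and "enat k = in_last I \<longleftrightarrow> \<gamma> \<le> rho f (in_planes I k) x (in_trial I k)"
  using assms unfolding inner_loop_def by auto

lemma inner_loop_null_step:
  assumes "inner_loop f \<phi> C N \<gamma> \<gamma>' \<theta> M x R\<^sub>0 I" "1 \<le> k" "enat k < in_last I"
  shows "update_planes f \<phi> x (in_trial I k) (in_planes I k) (in_planes I (Suc k))"
    and "in_radius I (Suc k) =
          (if rho_tilde f \<phi> (in_planes I k) x (in_trial I k) < \<gamma>'
           then in_radius I k else in_radius I k / 2)"
  using assms unfolding inner_loop_def by auto

lemma inner_loop_start:
  assumes "inner_loop f \<phi> C N \<gamma> \<gamma>' \<theta> M x R\<^sub>0 I"
  shows "1 \<le> in_last I" "in_radius I 1 = R\<^sub>0" "admissible_planes f \<phi> x (in_planes I 1)"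
  using assms unfolding inner_loop_def by auto

lemma inner_loop_admissible:
  assumes I: "inner_loop f \<phi> C N \<gamma> \<gamma>' \<theta> M x R\<^sub>0 I" and "1 \<le> k" "enat k \<le> in_last I"
  shows "admissible_planes f \<phi> x (in_planes I k)"
proof (cases "k = 1")
  case True
  then show ?thesis using inner_loop_start(3)[OF I] by simp
next
  case False
  then obtain m where "k = Suc m" "1 \<le> m" using \<open>1 \<le> k\<close> by (cases k) auto
  moreover from this have "enat m < in_last I"
    using \<open>enat k \<le> in_last I\<close> by (simp add: Suc_ile_eq)
  ultimately show ?thesis using inner_loop_null_step(1)[OF I] by (auto simp: update_planes_def)
qed

lemma inner_loop_radius_pos:
  assumes I: "inner_loop f \<phi> C N \<gamma> \<gamma>' \<theta> M x R\<^sub>0 I" and "0 < R\<^sub>0" and "1 \<le> k" "enat k \<le> in_last I"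
  shows "0 < in_radius I k"
  using \<open>1 \<le> k\<close> \<open>enat k \<le> in_last I\<close>
proof (induction k rule: dec_induct)
  case base
  then show ?case using inner_loop_start(2)[OF I] \<open>0 < R\<^sub>0\<close> by simp
next
  case (step k)
  then have "enat k < in_last I" by (simp add: Suc_ile_eq)
  then show ?case using step inner_loop_null_step(2)[OF I \<open>1 \<le> k\<close>] by auto
qed

text \<open>The ratio test accepts only steps whose predicted decrease is nonzero, because division by
  zero yields \<open>0 < \<gamma>\<close>. A nonnegative prediction is therefore positive and can be cleared from the
  denominator.\<close>
lemma serious_step:
  assumes I: "inner_loop f \<phi> C N \<gamma> \<gamma>' \<theta> M x R\<^sub>0 I" and k: "in_last I = enat k"
    and N: "is_norm N" and par: "0 < \<gamma>" "0 < \<theta>" "1 \<le> M" and "0 < R\<^sub>0"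
    and x: "x \<in> C" "\<phi> x x = f x"
  shows "0 < in_radius I k" "in_trial I k \<in> C" "N (in_trial I k - x) \<le> M * in_radius I k"
    and "f (in_trial I k) \<le> f x"
    and "\<And>w. w \<in> C \<Longrightarrow> N (w - x) \<le> in_radius I k
           \<Longrightarrow> \<gamma> * \<theta> * (f x - \<phi> w x) \<le> f x - f (in_trial I k)"
proof -
  have k1: "1 \<le> k" using inner_loop_start(1)[OF I] k by (simp add: one_enat_def)
  have kl: "enat k \<le> in_last I" using k by simp
  note S = inner_loop_step[OF I k1 kl]
  note G = inner_loop_admissible[OF I k1 kl]
  note dec = trial_step_decrease[OF G S(1,2) \<open>0 < \<theta>\<close>]
  show R: "0 < in_radius I k" by (rule inner_loop_radius_pos[OF I \<open>0 < R\<^sub>0\<close> k1 kl])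
  show "in_trial I k \<in> C" using S(2) by (simp add: trial_step_def)
  show "N (in_trial I k - x) \<le> M * in_radius I k"
    by (rule trial_step_length[OF N S(1,2) \<open>1 \<le> M\<close>])
  define D where "D = f x - working_model (in_planes I k) (in_trial I k) x"
  have "0 \<le> D" using dec[of x] x R by (simp add: D_def is_norm_zero[OF N])
  moreover have rho: "\<gamma> \<le> (f x - f (in_trial I k)) / D" using S(3) k by (simp add: rho_def D_def)
  moreover have "D \<noteq> 0" using rho \<open>0 < \<gamma>\<close> by auto
  ultimately have D: "0 < D" "\<gamma> * D \<le> f x - f (in_trial I k)" by (auto simp: pos_le_divide_eq)
  moreover have "0 \<le> \<gamma> * D" using D(1) \<open>0 < \<gamma>\<close> by simp
  ultimately show "f (in_trial I k) \<le> f x" by linarith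
  fix w assume "w \<in> C" "N (w - x) \<le> in_radius I k"
  then have "\<gamma> * (\<theta> * (f x - \<phi> w x)) \<le> \<gamma> * D"
    using dec[of w] \<open>0 < \<gamma>\<close> by (intro mult_left_mono) (auto simp: D_def)
  with D(2) show "\<gamma> * \<theta> * (f x - \<phi> w x) \<le> f x - f (in_trial I k)" by (simp add: mult.assoc)
qed

text \<open>At a rejected trial step the two ratios differ by \<open>(f z - \<phi>(z, x))/D\<close>, where \<open>D\<close> is the
  predicted decrease. If \<open>D\<close> is large compared with the error of the model, the second ratio must
  stay below \<open>\<gamma>'\<close> as well, and the radius is kept.\<close>
lemma null_step_keeps_radius:
  assumes D: "0 < f x - working_model G z x" and "rho f G x z < \<gamma>"
    and "f z - \<phi> z x \<le> (\<gamma>' - \<gamma>) * (f x - working_model G z x)"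
  shows "rho_tilde f \<phi> G x z < \<gamma>'"
  using assms by (simp add: rho_def rho_tilde_def pos_divide_less_eq algebra_simps)

text \<open>Near a noncritical point the predicted decrease is at least a fixed multiple of the radius,
  while by strictness the model error is an arbitrarily small multiple of it. The rejected steps are
  then due to a poor working model, which the added cutting planes improve without halving.\<close>
lemma no_halving_near_noncritical:
  fixes N f :: "'a::euclidean_space \<Rightarrow> real"
  assumes N: "is_norm N" and model: "strict_first_order_model N f \<Omega> \<phi>" and f: "isCont f x\<^sub>0"
    and C: "convex C" "C \<subseteq> \<Omega>" "x\<^sub>0 \<in> C" and noncrit: "\<not> critical_point f C x\<^sub>0"
    and par: "\<gamma> < \<gamma>'" "0 < \<theta>" "1 \<le> M"
  obtains \<delta> r where "0 < \<delta>" "0 < r"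
    and "\<And>x R\<^sub>0 I k. x \<in> C \<Longrightarrow> dist x x\<^sub>0 < \<delta> \<Longrightarrow> 0 < R\<^sub>0 \<Longrightarrow> R\<^sub>0 < r
           \<Longrightarrow> inner_loop f \<phi> C N \<gamma> \<gamma>' \<theta> M x R\<^sub>0 I \<Longrightarrow> 1 \<le> k \<Longrightarrow> enat k \<le> in_last I
           \<Longrightarrow> in_radius I k = R\<^sub>0"
proof -
  have fom: "first_order_model N f \<Omega> \<phi>" using model by (simp add: strict_first_order_model_def)
  have "x\<^sub>0 \<in> \<Omega>" using C by auto
  obtain c r \<delta>\<^sub>1 where cr: "0 < c" "0 < r" "0 < \<delta>\<^sub>1"
    and dec: "\<And>x R. x \<in> C \<Longrightarrow> dist x x\<^sub>0 < \<delta>\<^sub>1 \<Longrightarrow> 0 < R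
           \<Longrightarrow> \<exists>w\<in>C. N (w - x) \<le> R \<and> c * min R r \<le> f x - \<phi> w x"
    using uniform_model_decrease[OF N fom f C noncrit] by blast
  \<comment> \<open>The predicted decrease is at least \<open>\<theta> c R\<close> and the step length at most \<open>M R\<close>; this \<open>e\<close> makes
    the model error \<open>e M R\<close> equal to \<open>\<gamma>' - \<gamma>\<close> times the former.\<close>
  define e where "e = (\<gamma>' - \<gamma>) * \<theta> * c / M"
  have e: "0 < e" using par cr by (simp add: e_def)
  obtain \<delta>\<^sub>2 where \<delta>2: "0 < \<delta>\<^sub>2"
    "\<And>x z. dist x x\<^sub>0 < \<delta>\<^sub>2 \<Longrightarrow> dist z x\<^sub>0 < \<delta>\<^sub>2 \<Longrightarrow> f z \<le> \<phi> z x + e * N (z - x)"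
    using strict_model_locally_uniform[OF N model \<open>x\<^sub>0 \<in> \<Omega>\<close> e] by blast
  obtain K where K: "0 < K" "\<And>v. norm v \<le> K * N v" using is_norm_dominates[OF N] by blast
  \<comment> \<open>A trial step is shorter than \<open>K M r' \<le> \<delta>\<^sub>2 / 2\<close> and so cannot leave the ball in which the error
    bound holds.\<close>
  define r' where "r' = min r (\<delta>\<^sub>2 / (2 * K * M))"
  show thesis
  proof (rule that[of "min \<delta>\<^sub>1 (\<delta>\<^sub>2 / 2)" r'])
    show "0 < r'" using cr \<delta>2 K par by (simp add: r'_def)
    fix x R I k
    assume x: "x \<in> C" "dist x x\<^sub>0 < min \<delta>\<^sub>1 (\<delta>\<^sub>2 / 2)" and R: "0 < R" "R < r'"
      and I: "inner_loop f \<phi> C N \<gamma> \<gamma>' \<theta> M x R I" and k: "1 \<le> k" "enat k \<le> in_last I"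
    from k show "in_radius I k = R"
    proof (induction k rule: dec_induct)
      case base
      then show ?case using inner_loop_start(2)[OF I] by simp
    next
      case (step k)
      then have kl: "enat k < in_last I" by (simp add: Suc_ile_eq)
      then have kl': "enat k \<le> in_last I" by simp
      have rad: "in_radius I k = R" using step.IH kl' .
      define G z where "G = in_planes I k" and "z = in_trial I k"
      note S = inner_loop_step[OF I \<open>1 \<le> k\<close> kl', folded G_def z_def, unfolded rad]
      have G: "admissible_planes f \<phi> x G"
        unfolding G_def by (rule inner_loop_admissible[OF I \<open>1 \<le> k\<close> kl'])
      obtain w where w: "w \<in> C" "N (w - x) \<le> R" "c * min R r \<le> f x - \<phi> w x"
        using dec[of x R] x R by auto
      have Rr: "min R r = R" using R by (simp add: r'_def)
      define D where "D = f x - working_model G z x"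
      have "\<theta> * (c * R) \<le> \<theta> * (f x - \<phi> w x)" using w(3) par Rr by (intro mult_left_mono) auto
      also have "\<dots> \<le> D" unfolding D_def by (rule trial_step_decrease[OF G S(1,2) \<open>0 < \<theta>\<close> w(1,2)])
      finally have D: "\<theta> * (c * R) \<le> D" .
      then have "0 < D" using par cr R by (smt (verit) mult_pos_pos)
      have len: "N (z - x) \<le> M * R" by (rule trial_step_length[OF N S(1,2) \<open>1 \<le> M\<close>])
      have "f z - \<phi> z x \<le> e * N (z - x)"
      proof -
        have "dist z x \<le> K * N (z - x)" using K(2) by (simp add: dist_norm)
        also have "\<dots> \<le> K * (M * R)" using len K by simp
        also have "\<dots> < \<delta>\<^sub>2 / 2"
        proof -
          have "R < \<delta>\<^sub>2 / (2 * K * M)" using R by (simp add: r'_def)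
          then show ?thesis using K par by (simp add: pos_less_divide_eq algebra_simps)
        qed
        finally have "dist z x\<^sub>0 < \<delta>\<^sub>2" using dist_triangle[of z x\<^sub>0 x] x by simp
        then show ?thesis using \<delta>2(2)[of x z] x \<delta>2(1) by simp
      qed
      also have "\<dots> \<le> e * (M * R)" using len e by simp
      also have "\<dots> = (\<gamma>' - \<gamma>) * (\<theta> * (c * R))" using par by (simp add: e_def)
      also have "\<dots> \<le> (\<gamma>' - \<gamma>) * D" using D par by (intro mult_left_mono) auto
      finally have err: "f z - \<phi> z x \<le> (\<gamma>' - \<gamma>) * D" .
      have "rho f G x z < \<gamma>" using S(3) kl by auto
      then have "rho_tilde f \<phi> G x z < \<gamma>'"
        using null_step_keeps_radius[of f x G z \<gamma> \<phi> \<gamma>'] \<open>0 < D\<close> err by (simp add: D_def)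
      then show ?case
        using inner_loop_null_step(2)[OF I \<open>1 \<le> k\<close> kl] rad by (simp add: G_def z_def)
    qed
  qed (use cr \<delta>2 in auto)
qed


section \<open>The outer loop\<close>

text \<open>Near \<open>a\<close> a step of length at most \<open>B R\<close> uses up a decrease of at least \<open>c R\<close>; the minimum with \<open>r\<close> is harmless since
  the decreases tend to zero. Starting within \<open>\<delta>/2\<close> of \<open>a\<close> when the remaining decrease is less than
  \<open>c \<delta>/(2 B)\<close>, the sequence can travel less than \<open>\<delta>/2\<close> in total.\<close>
lemma descent_traps_iterates:
  fixes x :: "nat \<Rightarrow> 'a::metric_space" and F R :: "nat \<Rightarrow> real"
  assumes "decseq F" and lim: "F \<longlonglongrightarrow> L" and const: "0 < B" "0 < c" "0 < r" "0 < \<delta>"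
    and len: "\<And>j. dist (x (Suc j)) (x j) \<le> B * R j" and pos: "\<And>j. 0 < R j"
    and dec: "\<And>j. dist (x j) a < \<delta> \<Longrightarrow> c * min (R j) r \<le> F j - F (Suc j)"
    and freq: "\<exists>\<^sub>F j in sequentially. dist (x j) a < \<delta> / 2"
  shows "\<forall>\<^sub>F j in sequentially. dist (x j) a < \<delta>" and "R \<longlonglongrightarrow> 0"
proof -
  have ge: "L \<le> F j" for j using decseq_ge[OF \<open>decseq F\<close> lim] .
  define gap where "gap = min (c * r) (c * \<delta> / (2 * B))"
  have "0 < gap" using const by (simp add: gap_def)
  then have "\<forall>\<^sub>F j in sequentially. F j < L + gap" using order_tendstoD(2)[OF lim] by simp
  with freq have "\<exists>\<^sub>F j in sequentially. dist (x j) a < \<delta> / 2 \<and> F j < L + gap"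
    by (rule frequently_eventually_conj[THEN frequently_elim1]) auto
  then obtain j\<^sub>0 where j0: "dist (x j\<^sub>0) a < \<delta> / 2" "F j\<^sub>0 < L + gap"
    by (auto dest: frequently_ex)
  have rad: "R j \<le> (F j - F (Suc j)) / c" if "j\<^sub>0 \<le> j" "dist (x j) a < \<delta>" for j
  proof -
    have "F j \<le> F j\<^sub>0" using decseqD[OF \<open>decseq F\<close> that(1)] .
    then have "c * min (R j) r < c * r"
      using dec[OF that(2)] ge[of "Suc j"] j0(2) by (simp add: gap_def)
    then have "min (R j) r = R j" using const by auto
    then show ?thesis using dec[OF that(2)] const by (simp add: field_simps)
  qed
  have close: "dist (x j) a < \<delta>" if "dist (x j) (x j\<^sub>0) \<le> B / c * (F j\<^sub>0 - F j)" for j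
  proof -
    have "F j\<^sub>0 - F j < c * \<delta> / (2 * B)" using ge[of j] j0(2) by (simp add: gap_def)
    then have "B / c * (F j\<^sub>0 - F j) < \<delta> / 2" using const by (simp add: field_simps)
    then show ?thesis using that j0(1) dist_triangle[of "x j" a "x j\<^sub>0"] by linarith
  qed
  have travel: "dist (x j) (x j\<^sub>0) \<le> B / c * (F j\<^sub>0 - F j)" if "j\<^sub>0 \<le> j" for j
    using that
  proof (induction j rule: dec_induct)
    case (step j)
    have "dist (x (Suc j)) (x j) \<le> B * ((F j - F (Suc j)) / c)"
      using len[of j] mult_left_mono[OF rad[OF step.hyps(1) close[OF step.IH]], of B] const by simp
    then have "dist (x (Suc j)) (x j\<^sub>0)
        \<le> B * ((F j - F (Suc j)) / c) + B / c * (F j\<^sub>0 - F j)"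
      using step.IH dist_triangle[of "x (Suc j)" "x j\<^sub>0" "x j"] by linarith
    also have "\<dots> = B / c * (F j\<^sub>0 - F (Suc j))" by (simp add: algebra_simps diff_divide_distrib)
    finally show ?case .
  qed simp
  show "\<forall>\<^sub>F j in sequentially. dist (x j) a < \<delta>"
    using close travel by (auto simp: eventually_sequentially)
  show "R \<longlonglongrightarrow> 0"
  proof (rule tendsto_sandwich)
    show "\<forall>\<^sub>F j in sequentially. R j \<le> (F j - F (Suc j)) / c"
      using rad close travel by (auto simp: eventually_sequentially)
    show "\<forall>\<^sub>F j in sequentially. 0 \<le> R j" using pos by (simp add: less_imp_le)
    have "(\<lambda>j. (F j - F (Suc j)) / c) \<longlonglongrightarrow> (L - L) / c"
      using const by (intro tendsto_intros lim LIMSEQ_Suc) auto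
    then show "(\<lambda>j. (F j - F (Suc j)) / c) \<longlonglongrightarrow> 0" by simp
  qed simp
qed

lemma locally_lipschitz_isCont:
  assumes "locally_lipschitz f" shows "isCont f x"
proof -
  obtain u L where "0 < u" "L-lipschitz_on (cball x u) f"
    using assms unfolding locally_lipschitz_def by blast
  then have "continuous_on (ball x u) f"
    using lipschitz_on_continuous_on continuous_on_subset ball_subset_cball by blast
  then show ?thesis using \<open>0 < u\<close> by (simp add: continuous_on_eq_continuous_at)
qed

lemma accumulation_point_of_run_infinite:
  assumes "accumulation_point_of_run T l" shows "last_serious T = \<infinity>"
proof (rule ccontr)
  assume "last_serious T \<noteq> \<infinity>"
  then obtain n where n: "last_serious T = enat n" by (cases "last_serious T") auto
  have "infinite {j. 1 \<le> j \<and> enat j \<le> last_serious T \<and> serious T j \<in> UNIV}"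
    using assms open_UNIV unfolding accumulation_point_of_run_def by blast
  moreover have "{j. 1 \<le> j \<and> enat j \<le> last_serious T \<and> serious T j \<in> UNIV} \<subseteq> {..n}"
    using n by auto
  ultimately show False using finite_subset finite_atMost by blast
qed

text \<open>The shift by one turns the indices of the run, which start at \<open>1\<close>, into arbitrary naturals.\<close>
lemma accumulation_point_of_run_frequently:
  assumes "accumulation_point_of_run T l" "0 < e"
  shows "\<exists>\<^sub>F j in sequentially. dist (serious T (Suc j)) l < e"
  unfolding frequently_sequentially
proof
  fix n
  have "infinite {j. 1 \<le> j \<and> enat j \<le> last_serious T \<and> serious T j \<in> ball l e}"
    using assms unfolding accumulation_point_of_run_def by (meson open_ball centre_in_ball)
  then obtain m where "Suc n < m" "serious T m \<in> ball l e"
    unfolding infinite_nat_iff_unbounded by blast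
  then show "\<exists>j\<ge>n. dist (serious T (Suc j)) l < e"
    by (intro exI[of _ "m - 1"]) (auto simp: dist_commute)
qed

text \<open>A run that goes on forever meets no critical iterate, where it would stop, and no inner loop
  without an accepted step.\<close>
lemma infinite_run_step:
  assumes T: "bundle_trust_region_run f \<phi> C N \<gamma> \<gamma>' \<Gamma> \<theta> M x\<^sub>1 T" and inf: "last_serious T = \<infinity>"
    and "1 \<le> j"
  obtains k where "inner_loop f \<phi> C N \<gamma> \<gamma>' \<theta> M (serious T j) (memory_radius T j) (inner_at T j)"
    and "in_last (inner_at T j) = enat k"
    and "serious T (Suc j) = in_trial (inner_at T j) k"
    and "memory_radius T (Suc j) = in_radius (inner_at T j) k
           \<or> memory_radius T (Suc j) = 2 * in_radius (inner_at T j) k"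
proof -
  have A: "\<not> critical_point f C (serious T j)"
    using T inf \<open>1 \<le> j\<close> unfolding bundle_trust_region_run_def by auto
  then have B: "inner_loop f \<phi> C N \<gamma> \<gamma>' \<theta> M (serious T j) (memory_radius T j) (inner_at T j)"
    using T inf \<open>1 \<le> j\<close> unfolding bundle_trust_region_run_def by auto
  obtain k where "in_last (inner_at T j) = enat k"
    "serious T (Suc j) = in_trial (inner_at T j) k"
    "memory_radius T (Suc j) =
       (if rho f (in_planes (inner_at T j) k) (serious T j) (in_trial (inner_at T j) k) < \<Gamma>
        then in_radius (inner_at T j) k else 2 * in_radius (inner_at T j) k)"
    using T inf \<open>1 \<le> j\<close> unfolding bundle_trust_region_run_def by (metis enat_ord_simps(4) enat.distinct(1))
  with B that show thesis by (metis (full_types))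
qed

theorem theorem1:
  fixes f :: "real ^ 'n \<Rightarrow> real"
    and \<phi> :: "real ^ 'n \<Rightarrow> real ^ 'n \<Rightarrow> real"
    and C \<Omega> :: "(real ^ 'n) set"
    and N :: "real ^ 'n \<Rightarrow> real"
    and \<gamma> \<gamma>' \<Gamma> \<theta> M :: real
    and x\<^sub>1 x_star :: "real ^ 'n"
    and T :: "(real ^ 'n) tr_run"
  assumes "is_norm N"
    and "0 < \<gamma>" and "\<gamma> < \<gamma>'" and "\<gamma>' < 1"
    and "\<gamma> < \<Gamma>" and "\<Gamma> \<le> 1"
    and "0 < \<theta>" and "\<theta> < 1" and "1 \<le> M"
    and "locally_lipschitz f"
    and "closed C" and "convex C"
    and "C \<subseteq> \<Omega>" and "strict_first_order_model N f \<Omega> \<phi>"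
    and "x\<^sub>1 \<in> C" and "bounded {x \<in> C. f x \<le> f x\<^sub>1}"
    and "bundle_trust_region_run f \<phi> C N \<gamma> \<gamma>' \<Gamma> \<theta> M x\<^sub>1 T"
    and "accumulation_point_of_run T x_star"
  shows "critical_point f C x_star"
proof (rule ccontr)
  assume noncrit: "\<not> critical_point f C x_star"
  note N = \<open>is_norm N\<close> and T = \<open>bundle_trust_region_run f \<phi> C N \<gamma> \<gamma>' \<Gamma> \<theta> M x\<^sub>1 T\<close>
    and acc = \<open>accumulation_point_of_run T x_star\<close> and strict = \<open>strict_first_order_model N f \<Omega> \<phi>\<close>
  have model: "first_order_model N f \<Omega> \<phi>"
    using strict by (simp add: strict_first_order_model_def)
  have cont: "isCont f x_star" by (rule locally_lipschitz_isCont) fact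
  note inf = accumulation_point_of_run_infinite[OF acc]
  define x where "x j = serious T (Suc j)" for j
  define I where "I j = inner_at T (Suc j)" for j
  define m where "m j = memory_radius T (Suc j)" for j
  define k where "k j = the_enat (in_last (I j))" for j
  define R where "R j = in_radius (I j) (k j)" for j
  have loop: "inner_loop f \<phi> C N \<gamma> \<gamma>' \<theta> M (x j) (m j) (I j)"
    and last: "in_last (I j) = enat (k j)"
    and x_Suc: "x (Suc j) = in_trial (I j) (k j)"
    and m_Suc: "m (Suc j) = R j \<or> m (Suc j) = 2 * R j" for j
  proof -
    obtain k' where "inner_loop f \<phi> C N \<gamma> \<gamma>' \<theta> M (x j) (m j) (I j)"
      and k': "in_last (I j) = enat k'" and "x (Suc j) = in_trial (I j) k'"
      and "m (Suc j) = in_radius (I j) k' \<or> m (Suc j) = 2 * in_radius (I j) k'"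
      unfolding x_def I_def m_def
      by (rule infinite_run_step[OF T inf, of "Suc j"]) simp
    moreover have "k j = k'" by (simp add: k_def k')
    ultimately show "inner_loop f \<phi> C N \<gamma> \<gamma>' \<theta> M (x j) (m j) (I j)"
      and "in_last (I j) = enat (k j)" and "x (Suc j) = in_trial (I j) (k j)"
      and "m (Suc j) = R j \<or> m (Suc j) = 2 * R j"
      unfolding R_def by simp_all
  qed
  have k1: "1 \<le> k j" "enat (k j) \<le> in_last (I j)" for j
    using inner_loop_start(1)[OF loop[of j]] last[of j] by (auto simp: one_enat_def)

  have inv: "x j \<in> C \<and> 0 < m j" for j
  proof (induction j)
    case 0
    then show ?case using T \<open>x\<^sub>1 \<in> C\<close> by (simp add: bundle_trust_region_run_def x_def m_def)
  next
    case (Suc j)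
    then have "x j \<in> C" "0 < m j" by auto
    moreover from this have "\<phi> (x j) (x j) = f (x j)"
      using first_order_modelD(2)[OF model] \<open>C \<subseteq> \<Omega>\<close> by auto
    ultimately show ?case
      using serious_step(1,2)[OF loop last N \<open>0 < \<gamma>\<close> \<open>0 < \<theta>\<close> \<open>1 \<le> M\<close>] x_Suc m_Suc[of j]
      by (auto simp: R_def)
  qed
  then have xC: "x j \<in> C" and m_pos: "0 < m j" and xx: "\<phi> (x j) (x j) = f (x j)" for j
    using first_order_modelD(2)[OF model] \<open>C \<subseteq> \<Omega>\<close> by auto
  note step = serious_step[OF loop last N \<open>0 < \<gamma>\<close> \<open>0 < \<theta>\<close> \<open>1 \<le> M\<close> m_pos xC xx,
      folded x_Suc R_def]

  have freq: "\<exists>\<^sub>F j in sequentially. dist (x j) x_star < e" if "0 < e" for e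
    unfolding x_def by (rule accumulation_point_of_run_frequently[OF acc that])
  have "x_star \<in> C"
  proof -
    have "\<exists>y\<in>C. dist y x_star < e" if "0 < e" for e
      using frequently_ex[OF freq[OF that]] xC by blast
    then show ?thesis using closed_approachable[OF \<open>closed C\<close>] by blast
  qed

  define F where "F j = f (x j)" for j
  have "decseq F" using step(4) by (simp add: decseq_Suc_iff F_def)
  \<comment> \<open>A monotone sequence that comes arbitrarily close to a value infinitely often converges to it.\<close>
  have F_near: "\<exists>\<^sub>F j in sequentially. \<bar>F j - f x_star\<bar> < e" if "0 < e" for e
  proof -
    obtain d where "0 < d" "\<And>y. dist y x_star < d \<Longrightarrow> dist (f y) (f x_star) < e"
      using cont \<open>0 < e\<close> unfolding continuous_at_eps_delta by blast
    then show ?thesis using freq[of d]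
      by (auto simp: F_def dist_real_def elim!: frequently_elim1)
  qed
  have F_lim: "F \<longlonglongrightarrow> f x_star"
  proof (rule LIMSEQ_I)
    fix e :: real assume "0 < e"
    from frequently_ex[OF F_near[OF this]] obtain n where n: "\<bar>F n - f x_star\<bar> < e" by blast
    have "norm (F j - f x_star) < e" if "n \<le> j" for j
    proof -
      have "\<exists>i\<ge>j. \<bar>F i - f x_star\<bar> < e"
        using F_near[OF \<open>0 < e\<close>] unfolding frequently_sequentially by blast
      then obtain i where "j \<le> i" "\<bar>F i - f x_star\<bar> < e" by blast
      then show ?thesis using n decseqD[OF \<open>decseq F\<close> \<open>n \<le> j\<close>] decseqD[OF \<open>decseq F\<close> \<open>j \<le> i\<close>]
        by auto
    qed
    then show "\<exists>n. \<forall>j\<ge>n. norm (F j - f x_star) < e" by blast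
  qed

  obtain c r \<delta>\<^sub>1 where cr: "0 < c" "0 < r" "0 < \<delta>\<^sub>1"
    and model_dec: "\<And>x R. x \<in> C \<Longrightarrow> dist x x_star < \<delta>\<^sub>1 \<Longrightarrow> 0 < R
           \<Longrightarrow> \<exists>w\<in>C. N (w - x) \<le> R \<and> c * min R r \<le> f x - \<phi> w x"
    using uniform_model_decrease[OF N model cont \<open>convex C\<close> \<open>C \<subseteq> \<Omega>\<close> \<open>x_star \<in> C\<close> noncrit] by blast
  obtain \<delta>\<^sub>2 r' where r': "0 < \<delta>\<^sub>2" "0 < r'"
    and keep: "\<And>x R\<^sub>0 I k. x \<in> C \<Longrightarrow> dist x x_star < \<delta>\<^sub>2 \<Longrightarrow> 0 < R\<^sub>0 \<Longrightarrow> R\<^sub>0 < r'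
           \<Longrightarrow> inner_loop f \<phi> C N \<gamma> \<gamma>' \<theta> M x R\<^sub>0 I \<Longrightarrow> 1 \<le> k \<Longrightarrow> enat k \<le> in_last I
           \<Longrightarrow> in_radius I k = R\<^sub>0"
    using no_halving_near_noncritical[OF N strict cont \<open>convex C\<close> \<open>C \<subseteq> \<Omega>\<close> \<open>x_star \<in> C\<close> noncrit
        \<open>\<gamma> < \<gamma>'\<close> \<open>0 < \<theta>\<close> \<open>1 \<le> M\<close>] by blast
  obtain K where K: "0 < K" "\<And>v. norm v \<le> K * N v" using is_norm_dominates[OF N] by blast
  define \<delta> where "\<delta> = min \<delta>\<^sub>1 \<delta>\<^sub>2"
  have dec: "(\<gamma> * \<theta> * c) * min (R j) r \<le> F j - F (Suc j)"
    if close: "dist (x j) x_star < \<delta>" for j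
  proof -
    obtain w where w: "w \<in> C" "N (w - x j) \<le> R j" "c * min (R j) r \<le> f (x j) - \<phi> w (x j)"
      using model_dec[OF xC _ step(1), of j j] close unfolding \<delta>_def by auto
    have "\<gamma> * \<theta> * (c * min (R j) r) \<le> \<gamma> * \<theta> * (f (x j) - \<phi> w (x j))"
      using w(3) \<open>0 < \<gamma>\<close> \<open>0 < \<theta>\<close> by (intro mult_left_mono) auto
    with step(5)[OF w(1,2)] show ?thesis by (simp add: F_def mult.assoc)
  qed
  have len: "dist (x (Suc j)) (x j) \<le> (K * M) * R j" for j
  proof -
    have "dist (x (Suc j)) (x j) \<le> K * N (x (Suc j) - x j)" using K(2) by (simp add: dist_norm)
    also have "\<dots> \<le> K * (M * R j)" using step(3) K(1) by simp
    finally show ?thesis by (simp add: mult.assoc)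
  qed
  have near: "\<forall>\<^sub>F j in sequentially. dist (x j) x_star < \<delta>" and R_lim: "R \<longlonglongrightarrow> 0"
    using descent_traps_iterates[OF \<open>decseq F\<close> F_lim, of "K * M" "\<gamma> * \<theta> * c" r \<delta> x R x_star]
      len dec step(1) freq[of "\<delta> / 2"] K cr r' \<open>0 < \<gamma>\<close> \<open>0 < \<theta>\<close> \<open>1 \<le> M\<close> by (auto simp: \<delta>_def)

  \<comment> \<open>The memory radius of the next loop is at most twice the accepted radius, hence below \<open>r'\<close> too.\<close>
  have "\<forall>\<^sub>F j in sequentially. R j < r' / 2" using order_tendstoD(2)[OF R_lim, of "r' / 2"] r' by simp
  moreover have "\<forall>\<^sub>F j in sequentially. dist (x (Suc j)) x_star < \<delta>"
    using sequentially_offset[OF near, of 1] by simp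
  ultimately have "\<forall>\<^sub>F j in sequentially. R j \<le> R (Suc j)"
  proof eventually_elim
    case (elim j)
    have "m (Suc j) < r'" using m_Suc[of j] elim(1) r'(2) by linarith
    then have "R (Suc j) = m (Suc j)"
      unfolding R_def using elim(2) by (intro keep[OF xC _ m_pos _ loop k1]) (auto simp: \<delta>_def)
    then show ?case using m_Suc[of j] step(1)[of j] by linarith
  qed
  then obtain n where mono: "\<And>j. n \<le> j \<Longrightarrow> R j \<le> R (Suc j)" by (auto simp: eventually_sequentially)
  have "R n \<le> R j" if "n \<le> j" for j
    using that by (induction j rule: dec_induct) (use mono order_trans in blast)+
  then have "R n \<le> 0" by (intro LIMSEQ_le_const[OF R_lim]) blast
  with step(1)[of n] show False by simp
qed

end
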